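(* Let $R$ be a ring, $M$ a nonzero uniformly finite $R$-module and $N$ a submodule of $M$ with $N\neq M$. For any primary decomposition of $N$ in $M$ there exists a refinement of it which is a uniform decomposition of $N$ in $M$.
   Context: Rings have $1$ and need not be commutative; module means left module. A submodule $N$ of $M$ is essential if $N\cap L\neq 0$ for every nonzero submodule $L$ of $M$. A module $U$ is uniform if $U\neq 0$ and every nonzero submodule of $U$ is essential in $U$. A module has finite uniform dimension if it contains no infinite direct sum of nonzero submodules; then $\operatorname{u.dim}(M)$ is the number of summands in any essential direct sum of uniform submodules of $M$ ($0$ if $M=0$). Modules $M_1,M_2$ are essentially equivalent if there are essential submodules $L_1\subseteq M_1$, $L_2\subseteq M_2$ with $L_1\simeq L_2$; $[M]$ denotes the equivalence class of $M$. For a module $M$ of finite uniform dimension, $\operatorname{As}_R(M)=\{[U] : U \text{ is a uniform submodule of } M\}$. An $R$-module $M$ is uniformly finite if every factor module of $M$ has finite uniform dimension. A submodule $N$ of $M$ is primary if $\operatorname{u.dim}(M/N)<\infty$ and $\operatorname{As}_R(M/N)$ consists of a single element. A primary decomposition of $N$ in $M$ is an expression $N=N_1\cap\cdots\cap N_s$ ($s\ge 1$ finite) with each $N_i$ a primary submodule of $M$. A uniform decomposition of $N$ in $M$ is an expression $N=N_1\cap\cdots\cap N_s$ ($s\geq 1$ finite) with submodules $N_i$ of $M$ such that each $M/N_i$ is a uniform module (every uniform decomposition is a primary decomposition). A primary decomposition $N=\bigcap_{i=1}^tN_i$ is a refinement of a primary decomposition $N=\bigcap_{j=1}^sM_j$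 if $\{1,\ldots,t\}$ is a disjoint union of non-empty subsets $I_1,\ldots,I_s$ such that, for each $j=1,\ldots,s$, $M_j=\bigcap_{k\in I_j}N_k$ and $\operatorname{As}_R(M/N_k)=\operatorname{As}_R(M/M_j)$ for all $k\in I_j$. *)

theory Defs
  imports "HOL-Algebra.Module" "HOL-Algebra.AbelCoset" "HOL-Library.Disjoint_Sets"
begin

text \<open>The library locale \<^locale>\<open>module\<close> requires a commutative ring of scalars, so left modules
  over an arbitrary unital ring are introduced here on the same record type.  The library locale
  \<^locale>\<open>submodule\<close> makes no commutativity assumption and is reused; as in the library, the
  fields \<open>mult\<close> and \<open>one\<close> of a module record carry no meaning.\<close>

locale left_module = R?: ring R + M?: abelian_group M for R (structure) and M (structure) +
  assumes smult_closed [simp, intro]: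
      "\<lbrakk>a \<in> carrier R; x \<in> carrier M\<rbrakk> \<Longrightarrow> a \<odot>\<^bsub>M\<^esub> x \<in> carrier M"
    and smult_l_distr:
      "\<lbrakk>a \<in> carrier R; b \<in> carrier R; x \<in> carrier M\<rbrakk> \<Longrightarrow>
        (a \<oplus> b) \<odot>\<^bsub>M\<^esub> x = a \<odot>\<^bsub>M\<^esub> x \<oplus>\<^bsub>M\<^esub> b \<odot>\<^bsub>M\<^esub> x"
    and smult_r_distr:
      "\<lbrakk>a \<in> carrier R; x \<in> carrier M; y \<in> carrier M\<rbrakk> \<Longrightarrow>
        a \<odot>\<^bsub>M\<^esub> (x \<oplus>\<^bsub>M\<^esub> y) = a \<odot>\<^bsub>M\<^esub> x \<oplus>\<^bsub>M\<^esub> a \<odot>\<^bsub>M\<^esub> y"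
    and smult_assoc:
      "\<lbrakk>a \<in> carrier R; b \<in> carrier R; x \<in> carrier M\<rbrakk> \<Longrightarrow>
        (a \<otimes> b) \<odot>\<^bsub>M\<^esub> x = a \<odot>\<^bsub>M\<^esub> (b \<odot>\<^bsub>M\<^esub> x)"
    and smult_one [simp]:
      "x \<in> carrier M \<Longrightarrow> \<one> \<odot>\<^bsub>M\<^esub> x = x"

abbreviation restr :: "('r, 'm, 'y) module_scheme \<Rightarrow> 'm set \<Rightarrow> ('r, 'm, 'y) module_scheme"
  where "restr M L \<equiv> M\<lparr>carrier := L\<rparr>"

definition quot_module :: "('r, 'm, 'y) module_scheme \<Rightarrow> 'm set \<Rightarrow> ('r, 'm set) module"
  where "quot_module M N =
    \<lparr>carrier = a_rcosets\<^bsub>M\<^esub> N, mult = undefined, one = undefined, zero = N, add = set_add M,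
     smult = (\<lambda>a X. \<Union>x\<in>X. N +>\<^bsub>M\<^esub> (a \<odot>\<^bsub>M\<^esub> x))\<rparr>"

definition module_iso ::
    "('r, 'x) ring_scheme \<Rightarrow> ('r, 'm, 'y) module_scheme \<Rightarrow> ('r, 'n, 'z) module_scheme \<Rightarrow> bool"
  where "module_iso R M M' \<longleftrightarrow>
    (\<exists>f. bij_betw f (carrier M) (carrier M') \<and>
         (\<forall>x\<in>carrier M. \<forall>y\<in>carrier M. f (x \<oplus>\<^bsub>M\<^esub> y) = f x \<oplus>\<^bsub>M'\<^esub> f y) \<and>
         (\<forall>a\<in>carrier R. \<forall>x\<in>carrier M. f (a \<odot>\<^bsub>M\<^esub> x) = a \<odot>\<^bsub>M'\<^esub> f x))"

definition essential ::
    "('r, 'x) ring_scheme \<Rightarrow> ('r, 'm, 'y) module_scheme \<Rightarrow> 'm set \<Rightarrow> bool"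
  where "essential R M N \<longleftrightarrow> submodule N R M \<and>
    (\<forall>L. submodule L R M \<and> L \<noteq> {\<zero>\<^bsub>M\<^esub>} \<longrightarrow> N \<inter> L \<noteq> {\<zero>\<^bsub>M\<^esub>})"

definition uniform_module :: "('r, 'x) ring_scheme \<Rightarrow> ('r, 'm, 'y) module_scheme \<Rightarrow> bool"
  where "uniform_module R U \<longleftrightarrow> carrier U \<noteq> {\<zero>\<^bsub>U\<^esub>} \<and>
    (\<forall>L. submodule L R U \<and> L \<noteq> {\<zero>\<^bsub>U\<^esub>} \<longrightarrow> essential R U L)"

definition sum_is_direct :: "('r, 'm, 'y) module_scheme \<Rightarrow> 'm set set \<Rightarrow> bool"
  where "sum_is_direct M S \<longleftrightarrow>
    (\<forall>F x. finite F \<and> F \<subseteq> S \<and> (\<forall>L\<in>F. x L \<in> L) \<and> finsum M x F = \<zero>\<^bsub>M\<^esub>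
       \<longrightarrow> (\<forall>L\<in>F. x L = \<zero>\<^bsub>M\<^esub>))"

text \<open>The summands of a direct sum of nonzero submodules are pairwise distinct, so families of
  summands may be taken to be sets of submodules.\<close>

definition finite_udim :: "('r, 'x) ring_scheme \<Rightarrow> ('r, 'm, 'y) module_scheme \<Rightarrow> bool"
  where "finite_udim R M \<longleftrightarrow>
    \<not> (\<exists>S. infinite S \<and> (\<forall>L\<in>S. submodule L R M \<and> L \<noteq> {\<zero>\<^bsub>M\<^esub>}) \<and> sum_is_direct M S)"

definition ess_equiv ::
    "('r, 'x) ring_scheme \<Rightarrow> ('r, 'm, 'y) module_scheme \<Rightarrow> ('r, 'n, 'z) module_scheme \<Rightarrow> bool"
  where "ess_equiv R M M' \<longleftrightarrow>
    (\<exists>L L'. essential R M L \<and> essential R M' L' \<and> module_iso R (restr M L) (restr M' L'))"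

text \<open>The class of a module is taken among the modules whose elements live in the same type.  All
  classes compared below come from factor modules of one module \<open>M\<close>, hence from modules over the
  single type \<open>'m set\<close>; two such classes are equal iff the modules are essentially equivalent.\<close>

definition ess_class ::
    "('r, 'x) ring_scheme \<Rightarrow> ('r, 'm, 'y) module_scheme \<Rightarrow> ('r, 'm, 'y) module_scheme set"
  where "ess_class R M = {M'. left_module R M' \<and> ess_equiv R M M'}"

definition As ::
    "('r, 'x) ring_scheme \<Rightarrow> ('r, 'm, 'y) module_scheme \<Rightarrow> ('r, 'm, 'y) module_scheme set set"
  where "As R M = {ess_class R (restr M U) | U. submodule U R M \<and> uniform_module R (restr M U)}"

definition uniformly_finite :: "('r, 'x) ring_scheme \<Rightarrow> ('r, 'm, 'y) module_scheme \<Rightarrow> bool"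
  where "uniformly_finite R M \<longleftrightarrow>
    (\<forall>L. submodule L R M \<longrightarrow> finite_udim R (quot_module M L))"

definition primary_submodule ::
    "('r, 'x) ring_scheme \<Rightarrow> ('r, 'm, 'y) module_scheme \<Rightarrow> 'm set \<Rightarrow> bool"
  where "primary_submodule R M N \<longleftrightarrow> submodule N R M \<and>
    finite_udim R (quot_module M N) \<and> (\<exists>c. As R (quot_module M N) = {c})"

text \<open>A decomposition with \<open>s\<close> components is given by \<open>s\<close> and a family \<open>Ns\<close>, of which only the
  members \<open>Ns 1, \<dots>, Ns s\<close> matter; repetitions are allowed.\<close>

definition primary_decomposition ::
    "('r, 'x) ring_scheme \<Rightarrow> ('r, 'm, 'y) module_scheme \<Rightarrow> 'm set \<Rightarrow> nat \<Rightarrow> (nat \<Rightarrow> 'm set) \<Rightarrow> bool"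
  where "primary_decomposition R M N s Ns \<longleftrightarrow>
    s \<ge> 1 \<and> (\<forall>i\<in>{1..s}. primary_submodule R M (Ns i)) \<and> N = (\<Inter>i\<in>{1..s}. Ns i)"

definition uniform_decomposition ::
    "('r, 'x) ring_scheme \<Rightarrow> ('r, 'm, 'y) module_scheme \<Rightarrow> 'm set \<Rightarrow> nat \<Rightarrow> (nat \<Rightarrow> 'm set) \<Rightarrow> bool"
  where "uniform_decomposition R M N s Ns \<longleftrightarrow>
    s \<ge> 1 \<and> (\<forall>i\<in>{1..s}. submodule (Ns i) R M \<and> uniform_module R (quot_module M (Ns i))) \<and>
    N = (\<Inter>i\<in>{1..s}. Ns i)"

definition refinement ::
    "('r, 'x) ring_scheme \<Rightarrow> ('r, 'm, 'y) module_scheme \<Rightarrow> 'm set \<Rightarrow>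
      nat \<Rightarrow> (nat \<Rightarrow> 'm set) \<Rightarrow> nat \<Rightarrow> (nat \<Rightarrow> 'm set) \<Rightarrow> bool"
  \<comment> \<open>the decomposition \<open>(t, Ns)\<close> of \<open>N\<close> refines the decomposition \<open>(s, Ms)\<close> of \<open>N\<close>\<close>
  where "refinement R M N t Ns s Ms \<longleftrightarrow>
    primary_decomposition R M N t Ns \<and> primary_decomposition R M N s Ms \<and>
    (\<exists>I :: nat \<Rightarrow> nat set.
       (\<forall>j\<in>{1..s}. I j \<noteq> {}) \<and> disjoint_family_on I {1..s} \<and> (\<Union>j\<in>{1..s}. I j) = {1..t} \<and>
       (\<forall>j\<in>{1..s}. Ms j = (\<Inter>k\<in>I j. Ns k) \<and>
          (\<forall>k\<in>I j. As R (quot_module M (Ns k)) = As R (quot_module M (Ms j)))))"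

end

theory Submission
  imports Defs
begin

text \<open>It suffices to refine each component \<open>P\<close> separately. Put \<open>Q = M/P\<close> and call \<open>K \<subseteq> Q\<close> a
  complement of a uniform \<open>U \<subseteq> Q\<close> if it is maximal among the submodules that meet \<open>U\<close> trivially.
  By maximality \<open>Q/K\<close> is uniform and contains a copy of \<open>U\<close>, so its only class is \<open>[U]\<close>, the class
  of \<open>M/P\<close>. If no finite intersection of such complements were zero, one could keep choosing a
  uniform submodule \<open>U\<^sub>n\<close> inside \<open>K\<^sub>0 \<inter> \<dots> \<inter> K\<^sub>n\<^sub>-\<^sub>1\<close> together with a complement \<open>K\<^sub>n\<close>; the sum of the
  \<open>U\<^sub>n\<close> would be an infinite direct sum, which finite uniform dimension forbids. The preimages in
  \<open>M\<close> of finitely many \<open>K\<^sub>i\<close> with zero intersection are the required components.\<close>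

section \<open>Submodules and homomorphisms\<close>

context left_module
begin

lemma smult_l_null: "x \<in> carrier M \<Longrightarrow> \<zero> \<odot>\<^bsub>M\<^esub> x = \<zero>\<^bsub>M\<^esub>"
proof -
  assume x: "x \<in> carrier M"
  have "\<zero> \<odot>\<^bsub>M\<^esub> x \<oplus>\<^bsub>M\<^esub> \<zero> \<odot>\<^bsub>M\<^esub> x = (\<zero> \<oplus> \<zero>) \<odot>\<^bsub>M\<^esub> x"
    using x by (subst smult_l_distr) auto
  then have "\<zero> \<odot>\<^bsub>M\<^esub> x \<oplus>\<^bsub>M\<^esub> \<zero> \<odot>\<^bsub>M\<^esub> x = \<zero> \<odot>\<^bsub>M\<^esub> x" by simp
  then show ?thesis using x by (metis M.add.l_cancel_one R.zero_closed smult_closed)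
qed

lemma smult_r_null: "a \<in> carrier R \<Longrightarrow> a \<odot>\<^bsub>M\<^esub> \<zero>\<^bsub>M\<^esub> = \<zero>\<^bsub>M\<^esub>"
proof -
  assume a: "a \<in> carrier R"
  have "a \<odot>\<^bsub>M\<^esub> \<zero>\<^bsub>M\<^esub> \<oplus>\<^bsub>M\<^esub> a \<odot>\<^bsub>M\<^esub> \<zero>\<^bsub>M\<^esub> = a \<odot>\<^bsub>M\<^esub> (\<zero>\<^bsub>M\<^esub> \<oplus>\<^bsub>M\<^esub> \<zero>\<^bsub>M\<^esub>)"
    using a by (subst smult_r_distr) auto
  then have "a \<odot>\<^bsub>M\<^esub> \<zero>\<^bsub>M\<^esub> \<oplus>\<^bsub>M\<^esub> a \<odot>\<^bsub>M\<^esub> \<zero>\<^bsub>M\<^esub> = a \<odot>\<^bsub>M\<^esub> \<zero>\<^bsub>M\<^esub>" by simp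
  then show ?thesis using a by (metis M.add.l_cancel_one M.zero_closed smult_closed)
qed

lemma smult_minus_one: "x \<in> carrier M \<Longrightarrow> (\<ominus> \<one>) \<odot>\<^bsub>M\<^esub> x = \<ominus>\<^bsub>M\<^esub> x"
proof -
  assume x: "x \<in> carrier M"
  have "(\<ominus> \<one>) \<odot>\<^bsub>M\<^esub> x \<oplus>\<^bsub>M\<^esub> x = (\<ominus> \<one> \<oplus> \<one>) \<odot>\<^bsub>M\<^esub> x"
    using x by (subst smult_l_distr) auto
  also have "\<dots> = \<zero>\<^bsub>M\<^esub>" using x by (simp add: R.l_neg smult_l_null)
  finally show ?thesis using x by (metis M.minus_equality R.a_inv_closed R.one_closed smult_closed)
qed

text \<open>Closure under negation comes for free, because the negative of \<open>x\<close> is the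
  multiple of \<open>x\<close> by the negative of \<open>\<one>\<close>. Later proofs therefore
  check only zero, sums and scalar multiples.\<close>

lemma submodule_iff:
  "submodule H R M \<longleftrightarrow> H \<subseteq> carrier M \<and> \<zero>\<^bsub>M\<^esub> \<in> H \<and> (\<forall>x\<in>H. \<forall>y\<in>H. x \<oplus>\<^bsub>M\<^esub> y \<in> H) \<and>
    (\<forall>a\<in>carrier R. \<forall>x\<in>H. a \<odot>\<^bsub>M\<^esub> x \<in> H)" (is "?L = ?R")
proof
  assume ?L
  then interpret submodule H R M .
  show ?R using subset m_closed one_closed smult_closed by auto
next
  assume H: ?R
  have "\<ominus>\<^bsub>M\<^esub> x \<in> H" if "x \<in> H" for x
    using H that smult_minus_one[of x] by (metis R.a_inv_closed R.one_closed subsetD)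
  then show ?L
    using H by (auto intro!: submodule.intro subgroup.intro submodule_axioms.intro simp: a_inv_def)
qed

lemma submodule_minus: "submodule H R M \<Longrightarrow> x \<in> H \<Longrightarrow> \<ominus>\<^bsub>M\<^esub> x \<in> H"
  using smult_minus_one[of x] unfolding submodule_iff
  by (metis R.a_inv_closed R.one_closed subsetD)

lemma submodule_zero: "submodule {\<zero>\<^bsub>M\<^esub>} R M"
  by (simp add: submodule_iff smult_r_null)

lemma submodule_carrier: "submodule (carrier M) R M"
  by (simp add: submodule_iff)

lemma submodule_Int: "submodule H R M \<Longrightarrow> submodule K R M \<Longrightarrow> submodule (H \<inter> K) R M"
  unfolding submodule_iff by blast

lemma submodule_Inter:
  assumes "F \<noteq> {}" and F: "\<And>K. K \<in> F \<Longrightarrow> submodule K R M"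
  shows "submodule (\<Inter>F) R M"
  unfolding submodule_iff
proof (intro conjI ballI)
  obtain K where "K \<in> F" using assms(1) by blast
  with F[OF this] show "\<Inter>F \<subseteq> carrier M" unfolding submodule_iff by blast
qed (use F in \<open>auto simp: submodule_iff\<close>)

text \<open>Any two elements of the union already lie in one member of the chain. This is the upper
  bound required when Zorn's lemma produces complements.\<close>

lemma submodule_Union_chain:
  assumes "C \<noteq> {}" and C: "\<And>K. K \<in> C \<Longrightarrow> submodule K R M"
    and ch: "\<And>K L. K \<in> C \<Longrightarrow> L \<in> C \<Longrightarrow> K \<subseteq> L \<or> L \<subseteq> K"
  shows "submodule (\<Union>C) R M"
  unfolding submodule_iff
proof (intro conjI ballI)
  obtain K where "K \<in> C" using assms(1) by blast
  with C[OF this] show "\<zero>\<^bsub>M\<^esub> \<in> \<Union>C" unfolding submodule_iff by blast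
next
  fix x y assume "x \<in> \<Union>C" "y \<in> \<Union>C"
  then obtain K L where KL: "K \<in> C" "L \<in> C" "x \<in> K" "y \<in> L" by blast
  then have "(x \<in> L \<and> y \<in> L) \<or> (x \<in> K \<and> y \<in> K)" using ch[of K L] by blast
  then have "x \<oplus>\<^bsub>M\<^esub> y \<in> L \<or> x \<oplus>\<^bsub>M\<^esub> y \<in> K"
    using C[OF KL(1)] C[OF KL(2)] by (auto simp: submodule_iff)
  then show "x \<oplus>\<^bsub>M\<^esub> y \<in> \<Union>C" using KL by blast
next
  show "\<Union>C \<subseteq> carrier M" using C unfolding submodule_iff by (meson Sup_least)
  fix a x assume "a \<in> carrier R" "x \<in> \<Union>C"
  then show "a \<odot>\<^bsub>M\<^esub> x \<in> \<Union>C" using C unfolding submodule_iff by (meson UnionE UnionI)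
qed

lemma left_module_restr:
  assumes H: "submodule H R M" shows "left_module R (restr M H)"
proof -
  have c: "x \<in> carrier M" if "x \<in> H" for x using H that unfolding submodule_iff by blast
  have "\<exists>y\<in>H. y \<oplus>\<^bsub>M\<^esub> x = \<zero>\<^bsub>M\<^esub>" if "x \<in> H" for x
    using submodule_minus[OF H that] c[OF that] M.l_neg by blast
  then have "abelian_group (restr M H)"
    using H c unfolding submodule_iff by (intro abelian_groupI) (auto simp: M.a_ac)
  then show ?thesis
    using H c unfolding submodule_iff
    by (auto intro!: left_module.intro left_module_axioms.intro R.ring_axioms
        simp: smult_l_distr smult_r_distr smult_assoc)
qed

text \<open>Allows uniformity and essentiality of \<open>restr M H\<close>, which quantify over
  submodules of the restricted record, to be discussed inside \<open>M\<close>.\<close>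

lemma submodule_restr_iff:
  assumes H: "submodule H R M"
  shows "submodule L R (restr M H) \<longleftrightarrow> submodule L R M \<and> L \<subseteq> H"
  using H unfolding left_module.submodule_iff[OF left_module_restr[OF H]]
  by (auto simp: submodule_iff)

lemma submodule_finsum:
  assumes H: "submodule H R M" and "finite F" and "\<And>i. i \<in> F \<Longrightarrow> x i \<in> H"
  shows "finsum M x F \<in> H"
  using assms(2,3)
proof (induction F)
  case empty
  then show ?case using H by (simp add: submodule_iff)
next
  case (insert i F)
  have "x \<in> F \<rightarrow> carrier M" "x i \<in> carrier M" using insert H unfolding submodule_iff by auto
  then have "finsum M x (insert i F) = x i \<oplus>\<^bsub>M\<^esub> finsum M x F"
    using insert by (simp add: M.finsum_insert)
  then show ?case using insert H unfolding submodule_iff by simp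
qed

lemma nonzero_element:
  "submodule H R M \<Longrightarrow> H \<noteq> {\<zero>\<^bsub>M\<^esub>} \<Longrightarrow> \<exists>x\<in>H. x \<noteq> \<zero>\<^bsub>M\<^esub>"
  unfolding submodule_iff by blast

end

locale left_module_hom = A: left_module R A + B: left_module R B
  for R :: "('r, 'x) ring_scheme" and A :: "('r, 'm, 'y) module_scheme"
    and B :: "('r, 'n, 'z) module_scheme" +
  fixes f :: "'m \<Rightarrow> 'n"
  assumes hom_closed: "x \<in> carrier A \<Longrightarrow> f x \<in> carrier B"
    and hom_add: "x \<in> carrier A \<Longrightarrow> y \<in> carrier A \<Longrightarrow> f (x \<oplus>\<^bsub>A\<^esub> y) = f x \<oplus>\<^bsub>B\<^esub> f y"
    and hom_smult: "a \<in> carrier R \<Longrightarrow> x \<in> carrier A \<Longrightarrow> f (a \<odot>\<^bsub>A\<^esub> x) = a \<odot>\<^bsub>B\<^esub> f x"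
begin

lemma hom_zero: "f \<zero>\<^bsub>A\<^esub> = \<zero>\<^bsub>B\<^esub>"
  using hom_add[of "\<zero>\<^bsub>A\<^esub>" "\<zero>\<^bsub>A\<^esub>"] hom_closed[of "\<zero>\<^bsub>A\<^esub>"]
  by (metis A.zero_closed A.l_zero B.add.l_cancel_one)

lemma hom_minus: "x \<in> carrier A \<Longrightarrow> f (\<ominus>\<^bsub>A\<^esub> x) = \<ominus>\<^bsub>B\<^esub> f x"
  using hom_add[of "\<ominus>\<^bsub>A\<^esub> x" x]
  by (simp add: A.l_neg hom_zero hom_closed B.minus_equality)

lemma submodule_vimage:
  assumes "submodule L R B" shows "submodule {x \<in> carrier A. f x \<in> L} R A"
  using assms unfolding A.submodule_iff B.submodule_iff
  by (auto simp: hom_zero hom_add hom_smult)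

lemma submodule_image:
  assumes "submodule L R A" shows "submodule (f ` L) R B"
proof -
  have c: "x \<in> carrier A" if "x \<in> L" for x using assms that unfolding A.submodule_iff by blast
  have "\<zero>\<^bsub>B\<^esub> \<in> f ` L" using assms hom_zero unfolding A.submodule_iff by (metis imageI)
  moreover have "f x \<oplus>\<^bsub>B\<^esub> f y \<in> f ` L" if "x \<in> L" "y \<in> L" for x y
    using assms that c hom_add[of x y] unfolding A.submodule_iff by (metis imageI)
  moreover have "a \<odot>\<^bsub>B\<^esub> f x \<in> f ` L" if "a \<in> carrier R" "x \<in> L" for a x
    using assms that c hom_smult[of a x] unfolding A.submodule_iff by (metis imageI)
  ultimately show ?thesis using c hom_closed unfolding B.submodule_iff by blast
qed

end

section \<open>Essential equivalence\<close>

text \<open>This is \<open>module_iso\<close> between \<open>restr A L\<close> and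
  \<open>restr B L'\<close> with the map exposed as a parameter and the operations taken from the
  ambient modules, so that maps can be inverted, restricted and composed.\<close>

definition iso_on ::
  "('r, 'x) ring_scheme \<Rightarrow> ('r, 'm, 'y) module_scheme \<Rightarrow> ('r, 'n, 'z) module_scheme \<Rightarrow>
    'm set \<Rightarrow> 'n set \<Rightarrow> ('m \<Rightarrow> 'n) \<Rightarrow> bool"
  where "iso_on R A B L L' f \<longleftrightarrow> bij_betw f L L' \<and>
    (\<forall>x\<in>L. \<forall>y\<in>L. f (x \<oplus>\<^bsub>A\<^esub> y) = f x \<oplus>\<^bsub>B\<^esub> f y) \<and>
    (\<forall>a\<in>carrier R. \<forall>x\<in>L. f (a \<odot>\<^bsub>A\<^esub> x) = a \<odot>\<^bsub>B\<^esub> f x)"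

lemma ess_equiv_iff:
  "ess_equiv R A B \<longleftrightarrow>
    (\<exists>L L' f. essential R A L \<and> essential R B L' \<and> iso_on R A B L L' f)"
  unfolding ess_equiv_def module_iso_def iso_on_def by auto

text \<open>The expected value of the inverse lies in \<open>L\<close> because \<open>L\<close> is a
  submodule, and \<open>f\<close> sends it to the right element; injectivity of \<open>f\<close> on
  \<open>L\<close> does the rest.\<close>

lemma iso_on_inv:
  assumes "left_module R A" "submodule L R A" and iso: "iso_on R A B L L' f"
  shows "iso_on R B A L' L (inv_into L f)"
proof -
  interpret A: left_module R A by fact
  let ?g = "inv_into L f"
  have bij: "bij_betw f L L'" using iso unfolding iso_on_def by blast
  have g: "?g y \<in> L" "f (?g y) = y" if "y \<in> L'" for y
    using bij that by (auto simp: bij_betw_def inv_into_into f_inv_into_f)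
  have gf: "?g (f x) = x" if "x \<in> L" for x using bij that by (simp add: bij_betw_def)
  have "?g (x \<oplus>\<^bsub>B\<^esub> y) = ?g x \<oplus>\<^bsub>A\<^esub> ?g y" if "x \<in> L'" "y \<in> L'" for x y
  proof -
    have "?g x \<oplus>\<^bsub>A\<^esub> ?g y \<in> L" using assms(2) g that unfolding A.submodule_iff by blast
    moreover have "f (?g x \<oplus>\<^bsub>A\<^esub> ?g y) = x \<oplus>\<^bsub>B\<^esub> y" using iso g that unfolding iso_on_def by simp
    ultimately show ?thesis using gf by metis
  qed
  moreover have "?g (a \<odot>\<^bsub>B\<^esub> y) = a \<odot>\<^bsub>A\<^esub> ?g y" if "a \<in> carrier R" "y \<in> L'" for a y
  proof -
    have "a \<odot>\<^bsub>A\<^esub> ?g y \<in> L" using assms(2) g that unfolding A.submodule_iff by blast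
    moreover have "f (a \<odot>\<^bsub>A\<^esub> ?g y) = a \<odot>\<^bsub>B\<^esub> y" using iso g that unfolding iso_on_def by simp
    ultimately show ?thesis using gf by metis
  qed
  ultimately show ?thesis using bij_betw_inv_into[OF bij] unfolding iso_on_def by blast
qed

text \<open>A nonzero submodule \<open>X\<close> meets the essential \<open>L\<close> in something
  nonzero. Its image under the injective \<open>f\<close> is a nonzero submodule of
  \<open>B\<close>, hence meets \<open>E\<close>, and a nonzero element there comes from
  \<open>L \<inter> X\<close>.\<close>

lemma essential_vimage_iso_on:
  assumes A: "left_module R A" and B: "left_module R B"
    and L: "essential R A L" and L': "submodule L' R B" and iso: "iso_on R A B L L' f"
    and E: "essential R B E"
  shows "essential R A {x \<in> L. f x \<in> E}"
proof -
  interpret A: left_module R A by fact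
  interpret B: left_module R B by fact
  have sL: "submodule L R A" using L by (simp add: essential_def)
  have bij: "bij_betw f L L'" using iso unfolding iso_on_def by blast
  interpret AL: left_module R "restr A L" by (rule A.left_module_restr[OF sL])
  \<comment> \<open>The map is linear only on \<open>L\<close>, so the source has to be the
    restricted module; the resulting submodules are then moved back to \<open>A\<close>.\<close>
  interpret f: left_module_hom R "restr A L" B f
    using iso L' unfolding iso_on_def B.submodule_iff
    by unfold_locales (auto simp: bij_betw_def)
  have sE: "submodule E R B" using E by (simp add: essential_def)
  have "submodule {x \<in> L. f x \<in> E} R A"
    using f.submodule_vimage[OF sE] A.submodule_restr_iff[OF sL] by simp
  moreover have "{x \<in> L. f x \<in> E} \<inter> X \<noteq> {\<zero>\<^bsub>A\<^esub>}" if X: "submodule X R A" "X \<noteq> {\<zero>\<^bsub>A\<^esub>}" for X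
  proof -
    have sLX: "submodule (L \<inter> X) R A" by (rule A.submodule_Int[OF sL X(1)])
    have "L \<inter> X \<noteq> {\<zero>\<^bsub>A\<^esub>}" using L X unfolding essential_def by blast
    then obtain x where x: "x \<in> L \<inter> X" "x \<noteq> \<zero>\<^bsub>A\<^esub>" using A.nonzero_element[OF sLX] by blast
    have inj: "inj_on f L" using bij by (simp add: bij_betw_def)
    have f0: "f \<zero>\<^bsub>A\<^esub> = \<zero>\<^bsub>B\<^esub>" using f.hom_zero by simp
    have z: "\<zero>\<^bsub>A\<^esub> \<in> L" using sL by (simp add: A.submodule_iff)
    have sI: "submodule (f ` (L \<inter> X)) R B"
      using f.submodule_image[of "L \<inter> X"] A.submodule_restr_iff[OF sL] sLX by blast
    have "f x \<noteq> \<zero>\<^bsub>B\<^esub>" using inj x z f0 by (metis IntD1 inj_onD)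
    then have "f ` (L \<inter> X) \<noteq> {\<zero>\<^bsub>B\<^esub>}" using x(1) by (metis imageI singletonD)
    then have "E \<inter> f ` (L \<inter> X) \<noteq> {\<zero>\<^bsub>B\<^esub>}" using E sI unfolding essential_def by blast
    then obtain y where "y \<in> E \<inter> f ` (L \<inter> X)" "y \<noteq> \<zero>\<^bsub>B\<^esub>"
      using B.nonzero_element[OF B.submodule_Int[OF sE sI]] by blast
    then obtain w where "w \<in> L \<inter> X" "f w \<in> E" "w \<noteq> \<zero>\<^bsub>A\<^esub>" using f0 by blast
    then show ?thesis by blast
  qed
  ultimately show ?thesis unfolding essential_def by blast
qed

lemma (in left_module) essential_Int:
  assumes "essential R M E" "essential R M E'" shows "essential R M (E \<inter> E')"
proof -
  have s: "submodule E R M" "submodule E' R M" using assms by (auto simp: essential_def)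
  have "E \<inter> E' \<inter> L \<noteq> {\<zero>\<^bsub>M\<^esub>}" if "submodule L R M" "L \<noteq> {\<zero>\<^bsub>M\<^esub>}" for L
    using assms that submodule_Int[OF s(2) that(1)] unfolding essential_def
    by (metis Int_assoc)
  then show ?thesis using s submodule_Int unfolding essential_def by blast
qed

lemma ess_equiv_sym:
  assumes "left_module R A" "ess_equiv R A B" shows "ess_equiv R B A"
proof -
  obtain L L' f where *: "essential R A L" "essential R B L'" "iso_on R A B L L' f"
    using assms(2) unfolding ess_equiv_iff by blast
  then have "submodule L R A" by (simp add: essential_def)
  from iso_on_inv[OF assms(1) this *(3)] * show ?thesis unfolding ess_equiv_iff by blast
qed

text \<open>The range of the first isomorphism and the domain of the second need not agree in
  \<open>B\<close>. Both maps are cut down to the intersection \<open>L' \<inter> K\<close>, which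
  is still essential, and then composed.\<close>

lemma ess_equiv_trans:
  assumes A: "left_module R A" and B: "left_module R B" and C: "left_module R C"
    and "ess_equiv R A B" "ess_equiv R B C"
  shows "ess_equiv R A C"
proof -
  obtain L L' f where f: "essential R A L" "essential R B L'" "iso_on R A B L L' f"
    using assms(4) unfolding ess_equiv_iff by blast
  obtain K K' g where g: "essential R B K" "essential R C K'" "iso_on R B C K K' g"
    using assms(5) unfolding ess_equiv_iff by blast
  have s: "submodule L R A" "submodule L' R B" "submodule K R B" "submodule K' R C"
    using f g by (auto simp: essential_def)
  let ?E = "L' \<inter> K" and ?h = "inv_into K g"
  have E: "essential R B ?E" by (rule left_module.essential_Int[OF B f(2) g(1)])
  have h: "iso_on R C B K' K ?h" by (rule iso_on_inv[OF B s(3) g(3)])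
  have bf: "inj_on f L" "f ` L = L'" and bg: "inj_on g K" "g ` K = K'"
    using f(3) g(3) by (auto simp: iso_on_def bij_betw_def)
  \<comment> \<open>\<open>?D'\<close> is the image of \<open>?E\<close> under \<open>g\<close>,
    written as a preimage under the inverse map so that \<open>essential_vimage_iso_on\<close>
    applies on both sides.\<close>
  let ?D = "{x \<in> L. f x \<in> ?E}" and ?D' = "{y \<in> K'. ?h y \<in> ?E}"
  have "essential R A ?D" by (rule essential_vimage_iso_on[OF A B f(1) s(2) f(3) E])
  moreover have "essential R C ?D'" by (rule essential_vimage_iso_on[OF C B g(2) s(3) h E])
  moreover have "iso_on R A C ?D ?D' (g \<circ> f)"
  proof -
    have "inj_on (g \<circ> f) ?D" using bf(1) bg(1) by (auto simp: inj_on_def)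
    moreover have "(g \<circ> f) ` ?D = ?D'"
    proof
      show "(g \<circ> f) ` ?D \<subseteq> ?D'" using bg by auto
      show "?D' \<subseteq> (g \<circ> f) ` ?D"
      proof
        fix y assume y: "y \<in> ?D'"
        then obtain x where x: "x \<in> L" "?h y = f x" using bf(2) by auto
        moreover have "g (?h y) = y" using y bg by (simp add: f_inv_into_f)
        ultimately show "y \<in> (g \<circ> f) ` ?D" using y by (auto intro!: image_eqI[of _ _ x])
      qed
    qed
    ultimately show ?thesis using f(3) g(3) unfolding iso_on_def bij_betw_def by simp
  qed
  ultimately show ?thesis unfolding ess_equiv_iff by blast
qed

lemma ess_class_eqI:
  assumes "left_module R A" "left_module R B" "ess_equiv R A B"
  shows "ess_class R A = ess_class R B"
proof -
  have BA: "ess_equiv R B A" by (rule ess_equiv_sym) fact+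
  show ?thesis
    unfolding ess_class_def
    using ess_equiv_trans[OF assms(1,2) _ assms(3)] ess_equiv_trans[OF assms(2,1) _ BA] by blast
qed

section \<open>Uniform submodules and their complements\<close>

context left_module
begin

text \<open>The symmetric form of uniformity: its negation directly supplies two nonzero submodules
  with zero intersection.\<close>

lemma uniform_module_iff:
  "uniform_module R M \<longleftrightarrow> carrier M \<noteq> {\<zero>\<^bsub>M\<^esub>} \<and>
    (\<forall>L K. submodule L R M \<and> submodule K R M \<and> L \<noteq> {\<zero>\<^bsub>M\<^esub>} \<and> K \<noteq> {\<zero>\<^bsub>M\<^esub>} \<longrightarrow> L \<inter> K \<noteq> {\<zero>\<^bsub>M\<^esub>})"
  unfolding uniform_module_def essential_def by blast

lemma uniform_restr_iff:
  assumes U: "submodule U R M"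
  shows "uniform_module R (restr M U) \<longleftrightarrow> U \<noteq> {\<zero>\<^bsub>M\<^esub>} \<and>
    (\<forall>L K. submodule L R M \<and> submodule K R M \<and> L \<subseteq> U \<and> K \<subseteq> U \<and> L \<noteq> {\<zero>\<^bsub>M\<^esub>} \<and> K \<noteq> {\<zero>\<^bsub>M\<^esub>}
      \<longrightarrow> L \<inter> K \<noteq> {\<zero>\<^bsub>M\<^esub>})"
  unfolding left_module.uniform_module_iff[OF left_module_restr[OF U]] submodule_restr_iff[OF U]
  by auto

lemma essential_in_uniform:
  assumes "submodule U R M" "uniform_module R (restr M U)"
    and "submodule L R M" "L \<subseteq> U" "L \<noteq> {\<zero>\<^bsub>M\<^esub>}"
  shows "essential R (restr M U) L"
  using assms submodule_restr_iff[OF assms(1)] unfolding uniform_module_def by simp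

text \<open>In a vanishing finite sum with a nonzero term, take the nonzero term of least index
  \<open>i\<close>. All other terms lie in \<open>K i\<close>, hence so does this one, contradicting
  \<open>U i \<inter> K i = 0\<close>. Both infinite constructions below are refuted by this
  lemma.\<close>

lemma no_independent_sequence:
  assumes fin: "finite_udim R M"
    and U: "\<And>n. submodule (U n) R M" "\<And>n. U n \<noteq> {\<zero>\<^bsub>M\<^esub>}"
    and K: "\<And>n. submodule (K n) R M" "\<And>n. U n \<inter> K n = {\<zero>\<^bsub>M\<^esub>}"
    and UK: "\<And>i j :: nat. i < j \<Longrightarrow> U j \<subseteq> K i"
  shows False
proof -
  \<comment> \<open>Directness is stated for a set of submodules, so the sequence must be injective
    for its range to be infinite. Equality would put \<open>U i\<close> inside
    \<open>K i\<close>.\<close>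
  have ne: "U i \<noteq> U j" if "i < j" for i j
    using UK[OF that] U(2)[of i] K(2)[of i] by blast
  then have "inj U" by (metis injI linorder_neqE_nat)
  then have "infinite (range U)" using finite_imageD infinite_UNIV_nat by blast
  moreover have "sum_is_direct M (range U)"
    unfolding sum_is_direct_def
  proof (intro allI impI, elim conjE, rule ccontr)
    fix F x
    assume F: "finite F" "F \<subseteq> range U" and x: "\<forall>L\<in>F. x L \<in> L" and sum0: "finsum M x F = \<zero>\<^bsub>M\<^esub>"
      and "\<not> (\<forall>L\<in>F. x L = \<zero>\<^bsub>M\<^esub>)"
    then have ex: "\<exists>i. U i \<in> F \<and> x (U i) \<noteq> \<zero>\<^bsub>M\<^esub>" by blast
    define i where "i = (LEAST i. U i \<in> F \<and> x (U i) \<noteq> \<zero>\<^bsub>M\<^esub>)"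
    have i: "U i \<in> F" "x (U i) \<noteq> \<zero>\<^bsub>M\<^esub>" using LeastI_ex[OF ex] unfolding i_def by blast+
    have min: "i \<le> j" if "U j \<in> F" "x (U j) \<noteq> \<zero>\<^bsub>M\<^esub>" for j
      unfolding i_def using that by (intro Least_le) blast
    have xc: "x L \<in> carrier M" if L: "L \<in> F" for L
    proof -
      obtain j where "L = U j" using F(2) L by blast
      then show ?thesis using x L U(1)[of j] unfolding submodule_iff by blast
    qed
    \<comment> \<open>By minimality of \<open>i\<close>, a term other than the one at
      \<open>U i\<close> is either zero or belongs to some \<open>U j\<close> with
      \<open>j > i\<close>.\<close>
    have "x L \<in> K i" if L: "L \<in> F - {U i}" for L
    proof (cases "x L = \<zero>\<^bsub>M\<^esub>")
      case True
      then show ?thesis using K(1)[of i] by (simp add: submodule_iff)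
    next
      case False
      obtain j where j: "L = U j" using F(2) L by blast
      have "i \<le> j" "i \<noteq> j" using min[of j] L False j by auto
      then have "U j \<subseteq> K i" using UK by simp
      then show ?thesis using x j L by blast
    qed
    then have rest: "finsum M x (F - {U i}) \<in> K i"
      using F(1) by (intro submodule_finsum[OF K(1)]) auto
    have rc: "finsum M x (F - {U i}) \<in> carrier M"
      using rest K(1)[of i] by (auto simp: submodule_iff)
    have "finsum M x (insert (U i) (F - {U i})) = x (U i) \<oplus>\<^bsub>M\<^esub> finsum M x (F - {U i})"
      using F(1) xc i by (intro M.finsum_insert) auto
    then have "x (U i) \<oplus>\<^bsub>M\<^esub> finsum M x (F - {U i}) = \<zero>\<^bsub>M\<^esub>"
      using sum0 i(1) by (simp add: insert_absorb)
    then have "x (U i) = \<ominus>\<^bsub>M\<^esub> finsum M x (F - {U i})"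
      using xc[OF i(1)] rc by (metis M.minus_equality)
    then have "x (U i) \<in> K i" using submodule_minus[OF K(1) rest] by simp
    then show False using K(2)[of i] x i by blast
  qed
  moreover have "\<forall>L\<in>range U. submodule L R M \<and> L \<noteq> {\<zero>\<^bsub>M\<^esub>}" using U by simp
  ultimately show False using fin unfolding finite_udim_def by (metis (no_types))
qed

text \<open>If \<open>V\<close> had no uniform submodule, every nonzero submodule of
  \<open>V\<close> would contain two nonzero submodules with zero intersection. Keeping one and
  splitting the other again, forever, yields an infinite direct sum.\<close>

lemma exists_uniform_submodule:
  assumes fin: "finite_udim R M" and V0: "submodule V R M" "V \<noteq> {\<zero>\<^bsub>M\<^esub>}"
  obtains U where "submodule U R M" "U \<subseteq> V" "uniform_module R (restr M U)"
proof (rule ccontr)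
  assume "\<not> thesis"
  then have nu: "\<not> uniform_module R (restr M W)" if "submodule W R M" "W \<subseteq> V" for W
    using that \<open>\<And>U. \<lbrakk>submodule U R M; U \<subseteq> V; uniform_module R (restr M U)\<rbrakk> \<Longrightarrow> thesis\<close> by blast
  \<comment> \<open>A state \<open>(A, W)\<close> consists of the summand \<open>A\<close> that is
    kept and the remainder \<open>W\<close> that is split next.\<close>
  define P where "P p \<longleftrightarrow> (case p of (A, W) \<Rightarrow> submodule A R M \<and> submodule W R M \<and>
    A \<subseteq> V \<and> W \<subseteq> V \<and> A \<noteq> {\<zero>\<^bsub>M\<^esub>} \<and> W \<noteq> {\<zero>\<^bsub>M\<^esub>} \<and> A \<inter> W = {\<zero>\<^bsub>M\<^esub>})" for p
  have split: "\<exists>p. P p \<and> fst p \<subseteq> W \<and> snd p \<subseteq> W"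
    if W: "submodule W R M" "W \<subseteq> V" "W \<noteq> {\<zero>\<^bsub>M\<^esub>}" for W
  proof -
    obtain A B where "submodule A R M" "submodule B R M" "A \<subseteq> W" "B \<subseteq> W"
      "A \<noteq> {\<zero>\<^bsub>M\<^esub>}" "B \<noteq> {\<zero>\<^bsub>M\<^esub>}" "A \<inter> B = {\<zero>\<^bsub>M\<^esub>}"
      using nu[OF W(1,2)] W(3) unfolding uniform_restr_iff[OF W(1)] by blast
    then show ?thesis using W(2) by (intro exI[of _ "(A, B)"]) (auto simp: P_def)
  qed
  have "\<exists>f. \<forall>n :: nat. P (f n) \<and> fst (f (Suc n)) \<subseteq> snd (f n) \<and> snd (f (Suc n)) \<subseteq> snd (f n)"
  proof (rule dependent_nat_choice[where P = "\<lambda>_. P"])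
    show "\<exists>p. P p" using split[OF V0(1) order_refl V0(2)] by blast
    show "\<exists>q. P q \<and> fst q \<subseteq> snd p \<and> snd q \<subseteq> snd p" if "P p" for p and n :: nat
      using that split[of "snd p"] unfolding P_def by (auto split: prod.splits)
  qed
  then obtain f where f: "\<And>n :: nat. P (f n)" "\<And>n. fst (f (Suc n)) \<subseteq> snd (f n)"
    "\<And>n. snd (f (Suc n)) \<subseteq> snd (f n)" by blast
  have dec: "snd (f j) \<subseteq> snd (f i)" if "i \<le> j" for i j
    by (rule lift_Suc_antimono_le[of "\<lambda>n. snd (f n)"]) (use f(3) that in auto)
  have "fst (f j) \<subseteq> snd (f i)" if "i < j" for i j
  proof -
    \<comment> \<open>The summand kept at stage \<open>j\<close> lies in the remainder of stage
      \<open>j - 1\<close>, and remainders decrease.\<close>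
    have "j = Suc (j - 1)" "i \<le> j - 1" using that by auto
    then show ?thesis using f(2)[of "j - 1"] dec[of i "j - 1"] by (metis order_trans)
  qed
  moreover have "submodule (fst (f n)) R M" "fst (f n) \<noteq> {\<zero>\<^bsub>M\<^esub>}" "submodule (snd (f n)) R M"
    "fst (f n) \<inter> snd (f n) = {\<zero>\<^bsub>M\<^esub>}" for n
    using f(1)[of n] unfolding P_def split_beta by blast+
  ultimately show False
    using no_independent_sequence[OF fin, of "\<lambda>n. fst (f n)" "\<lambda>n. snd (f n)"] by blast
qed

text \<open>The conditions on \<open>U\<close> are bundled with the maximality of \<open>K\<close>,
  so that a bare \<open>\<exists>U. uniform_complement U K\<close> records everything needed about
  the quotient by \<open>K\<close>.\<close>

definition uniform_complement :: "_ set \<Rightarrow> _ set \<Rightarrow> bool"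
  where "uniform_complement U K \<longleftrightarrow>
    submodule U R M \<and> uniform_module R (restr M U) \<and> submodule K R M \<and> U \<inter> K = {\<zero>\<^bsub>M\<^esub>} \<and>
    (\<forall>L. submodule L R M \<and> K \<subseteq> L \<and> U \<inter> L = {\<zero>\<^bsub>M\<^esub>} \<longrightarrow> L = K)"

text \<open>Zorn's lemma: a common element of \<open>U\<close> and the union of a chain already lies
  in \<open>U\<close> and a single member of the chain, so it is zero.\<close>

lemma exists_complement:
  assumes U: "submodule U R M" "uniform_module R (restr M U)"
  obtains K where "uniform_complement U K"
proof -
  let ?F = "{K. submodule K R M \<and> U \<inter> K = {\<zero>\<^bsub>M\<^esub>}}"
  have "\<exists>K\<in>?F. \<forall>X\<in>?F. K \<subseteq> X \<longrightarrow> X = K"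
  proof (rule subset_Zorn_nonempty)
    have "\<zero>\<^bsub>M\<^esub> \<in> U" using U(1) by (simp add: submodule_iff)
    then show "?F \<noteq> {}" using submodule_zero by blast
    fix C assume C: "C \<noteq> {}" "subset.chain ?F C"
    have "submodule (\<Union>C) R M"
      using C unfolding subset_chain_def by (intro submodule_Union_chain) blast+
    moreover have "U \<inter> \<Union>C = {\<zero>\<^bsub>M\<^esub>}" using C unfolding subset_chain_def by blast
    ultimately show "\<Union>C \<in> ?F" by blast
  qed
  then obtain K where "submodule K R M" "U \<inter> K = {\<zero>\<^bsub>M\<^esub>}"
    "\<And>L. submodule L R M \<Longrightarrow> K \<subseteq> L \<Longrightarrow> U \<inter> L = {\<zero>\<^bsub>M\<^esub>} \<Longrightarrow> L = K" by auto
  then have "uniform_complement U K" using U unfolding uniform_complement_def by simp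
  then show thesis by (rule that)
qed

text \<open>As long as the intersection of the complements chosen so far is nonzero, it contains a
  uniform submodule, whose complement can be added. A process that never stops would give a sequence
  excluded by \<open>no_independent_sequence\<close>.\<close>

lemma finite_complement_intersection:
  assumes fin: "finite_udim R M" and nz: "carrier M \<noteq> {\<zero>\<^bsub>M\<^esub>}"
  obtains F where "finite F" "F \<noteq> {}" "\<forall>K\<in>F. \<exists>U. uniform_complement U K"
    "\<Inter>F = {\<zero>\<^bsub>M\<^esub>}"
proof (rule ccontr)
  assume neg: "\<not> thesis"
  \<comment> \<open>Nonemptiness matters: \<open>\<Inter>{}\<close> is the whole type rather than
    \<open>carrier M\<close>.\<close>
  define G where "G F \<longleftrightarrow> finite F \<and> F \<noteq> {} \<and> (\<forall>K\<in>F. \<exists>U. uniform_complement U K)" for F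
  have no: "\<Inter>F \<noteq> {\<zero>\<^bsub>M\<^esub>}" if "G F" for F
    using neg that \<open>\<And>F. \<lbrakk>finite F; F \<noteq> {}; \<forall>K\<in>F. \<exists>U. uniform_complement U K;
      \<Inter>F = {\<zero>\<^bsub>M\<^esub>}\<rbrakk> \<Longrightarrow> thesis\<close> unfolding G_def by blast
  have step: "\<exists>U K. uniform_complement U K \<and> U \<subseteq> V"
    if "submodule V R M" "V \<noteq> {\<zero>\<^bsub>M\<^esub>}" for V
    using exists_uniform_submodule[OF fin that] exists_complement by metis
  \<comment> \<open>A state \<open>(U, K, F)\<close> holds the latest uniform submodule, its
    complement, and the set of all complements chosen so far.\<close>
  define P where "P p \<longleftrightarrow> (case p of (U, K, F) \<Rightarrow> uniform_complement U K \<and> K \<in> F \<and> G F)" for p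
  define S where "S p q \<longleftrightarrow> (case p of (U, K, F) \<Rightarrow> case q of (U', K', F') \<Rightarrow>
    U' \<subseteq> \<Inter>F \<and> F \<subseteq> F')" for p q :: "'c set \<times> 'c set \<times> 'c set set"
  have "\<exists>f. \<forall>n :: nat. P (f n) \<and> S (f n) (f (Suc n))"
  proof (rule dependent_nat_choice[where P = "\<lambda>_. P" and Q = "\<lambda>_. S"])
    obtain U K where "uniform_complement U K" using step[OF submodule_carrier nz] by blast
    then have "P (U, K, {K})" unfolding P_def G_def by auto
    then show "\<exists>p. P p" by blast
    fix p and n :: nat
    assume p: "P p"
    obtain U K F where p_eq: "p = (U, K, F)" by (cases p)
    have F: "G F" using p unfolding p_eq P_def by auto
    have "submodule (\<Inter>F) R M"
      using F unfolding G_def uniform_complement_def by (intro submodule_Inter) auto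
    then obtain U' K' where "uniform_complement U' K'" "U' \<subseteq> \<Inter>F"
      using step no[OF F] by blast
    then have "P (U', K', insert K' F) \<and> S p (U', K', insert K' F)"
      using F unfolding P_def S_def G_def p_eq by auto
    then show "\<exists>q. P q \<and> S p q" by blast
  qed
  then obtain f where f: "\<And>n :: nat. P (f n)" "\<And>n. S (f n) (f (Suc n))" by blast
  define U K F where "U n = fst (f n)" and "K n = fst (snd (f n))" and "F n = snd (snd (f n))" for n
  have UK: "uniform_complement (U n) (K n)" "K n \<in> F n" for n
    using f(1)[of n] by (auto simp: P_def U_def K_def F_def split_beta)
  have UF: "U (Suc n) \<subseteq> \<Inter>(F n)" "F n \<subseteq> F (Suc n)" for n
    using f(2)[of n] by (auto simp: S_def U_def K_def F_def split_beta)
  have mono: "F i \<subseteq> F j" if "i \<le> j" for i j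
    by (rule lift_Suc_mono_le[of F]) (use UF(2) that in auto)
  have "U j \<subseteq> K i" if "i < j" for i j
  proof -
    have "j = Suc (j - 1)" "i \<le> j - 1" using that by auto
    \<comment> \<open>The complement \<open>K i\<close> belongs to \<open>F i\<close>, hence to
      \<open>F (j - 1)\<close>, and \<open>U j\<close> was chosen inside the intersection of the
      latter.\<close>
    then show ?thesis using UF(1)[of "j - 1"] mono[of i "j - 1"] UK(2)[of i] 
      by (metis Inter_lower order_trans subsetD)
  qed
  moreover have "submodule (U n) R M" "U n \<noteq> {\<zero>\<^bsub>M\<^esub>}" "submodule (K n) R M" "U n \<inter> K n = {\<zero>\<^bsub>M\<^esub>}"
    for n
    using UK(1)[of n] uniform_restr_iff unfolding uniform_complement_def by auto
  ultimately show False using no_independent_sequence[OF fin, of U K] by blast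
qed

end

section \<open>Quotients by complements\<close>

context left_module_hom
begin

text \<open>The kernel meets \<open>U\<close> trivially, so \<open>f\<close> embeds \<open>U\<close>
  into \<open>B\<close>. A nonzero submodule of \<open>B\<close> has a preimage strictly larger than
  \<open>K\<close>, which meets \<open>U\<close> by maximality; uniformity of \<open>U\<close> thus
  passes to \<open>B\<close>. Stating this for a surjection with kernel \<open>K\<close> leaves open
  how the quotient is represented.\<close>

lemma uniform_of_complement:
  assumes surj: "f ` carrier A = carrier B"
    and comp: "A.uniform_complement U K"
    and ker: "K = {x \<in> carrier A. f x = \<zero>\<^bsub>B\<^esub>}"
  shows "uniform_module R B"
    and "\<And>V. submodule V R B \<Longrightarrow> uniform_module R (restr B V) \<Longrightarrow>
      ess_equiv R (restr A U) (restr B V)"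
proof -
  have U: "submodule U R A" and uU: "uniform_module R (restr A U)" and K: "submodule K R A"
    and UK: "U \<inter> K = {\<zero>\<^bsub>A\<^esub>}"
    and max: "\<And>L. submodule L R A \<Longrightarrow> K \<subseteq> L \<Longrightarrow> U \<inter> L = {\<zero>\<^bsub>A\<^esub>} \<Longrightarrow> L = K"
    using comp unfolding A.uniform_complement_def by blast+
  have Uc: "x \<in> carrier A" if "x \<in> U" for x using U that unfolding A.submodule_iff by blast
  have z: "\<zero>\<^bsub>A\<^esub> \<in> U" using U by (simp add: A.submodule_iff)
  \<comment> \<open>The part of \<open>U\<close> that \<open>f\<close> carries into
    \<open>L\<close>.\<close>
  define W where "W L = U \<inter> {x \<in> carrier A. f x \<in> L}" for L
  have sW: "submodule (W L) R A" if "submodule L R B" for L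
    unfolding W_def by (rule A.submodule_Int[OF U submodule_vimage[OF that]])
  have WU: "W L \<subseteq> U" for L unfolding W_def by blast
  have fU: "x = \<zero>\<^bsub>A\<^esub>" if "x \<in> U" "f x = \<zero>\<^bsub>B\<^esub>" for x
    using UK that Uc ker by blast
  \<comment> \<open>If this part were zero, maximality would make the preimage of \<open>L\<close>
    equal to \<open>K\<close>; surjectivity provides an element of it outside the kernel.\<close>
  have W: "W L \<noteq> {\<zero>\<^bsub>A\<^esub>}" if L: "submodule L R B" "L \<noteq> {\<zero>\<^bsub>B\<^esub>}" for L
  proof
    assume "W L = {\<zero>\<^bsub>A\<^esub>}"
    moreover have "K \<subseteq> {x \<in> carrier A. f x \<in> L}"
      using ker L(1) unfolding B.submodule_iff by auto
    ultimately have eq: "{x \<in> carrier A. f x \<in> L} = K"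
      using max[OF submodule_vimage[OF L(1)]] unfolding W_def by blast
    obtain y where y: "y \<in> L" "y \<noteq> \<zero>\<^bsub>B\<^esub>" using B.nonzero_element[OF L] by blast
    then have "y \<in> carrier B" using L(1) unfolding B.submodule_iff by blast
    then obtain x where "x \<in> carrier A" "f x = y" using surj by (metis imageE)
    then show False using eq y ker by blast
  qed
  have nzU: "U \<noteq> {\<zero>\<^bsub>A\<^esub>}" using uU A.uniform_restr_iff[OF U] by blast
  show uB: "uniform_module R B"
    unfolding B.uniform_module_iff
  proof (intro conjI allI impI, goal_cases)
    case 1
    obtain x where "x \<in> U" "x \<noteq> \<zero>\<^bsub>A\<^esub>" using A.nonzero_element[OF U nzU] by blast
    then show ?case using fU hom_closed Uc by blast
  next
    case (2 L L')
    then have sL: "submodule (W L) R A" "submodule (W L') R A" using sW by simp_all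
    have "W L \<noteq> {\<zero>\<^bsub>A\<^esub>}" "W L' \<noteq> {\<zero>\<^bsub>A\<^esub>}" using W 2 by simp_all
    then have "W L \<inter> W L' \<noteq> {\<zero>\<^bsub>A\<^esub>}"
      using uU sL WU[of L] WU[of L'] A.uniform_restr_iff[OF U] by metis
    then obtain x where x: "x \<in> W L \<inter> W L'" "x \<noteq> \<zero>\<^bsub>A\<^esub>"
      using A.nonzero_element[OF A.submodule_Int[OF sL]] by blast
    then have "f x \<in> L \<inter> L'" "f x \<noteq> \<zero>\<^bsub>B\<^esub>" using fU[of x] x unfolding W_def by blast+
    then show ?case by blast
  qed
  fix V assume V: "submodule V R B" and uV: "uniform_module R (restr B V)"
  have nzV: "V \<noteq> {\<zero>\<^bsub>B\<^esub>}" using uV B.uniform_restr_iff[OF V] by blast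
  \<comment> \<open>The essential equivalence is witnessed by \<open>W V\<close> and its image:
    nonzero submodules of the uniform modules \<open>U\<close> and \<open>V\<close>, matched by
    \<open>f\<close>.\<close>
  note WV = sW[OF V] WU[of V] W[OF V nzV]
  have essU: "essential R (restr A U) (W V)" by (rule A.essential_in_uniform[OF U uU WV])
  have sfW: "submodule (f ` W V) R B" by (rule submodule_image[OF WV(1)])
  obtain x where "x \<in> W V" "x \<noteq> \<zero>\<^bsub>A\<^esub>" using A.nonzero_element[OF WV(1,3)] by blast
  then have "f x \<in> f ` W V" "f x \<noteq> \<zero>\<^bsub>B\<^esub>" using fU WU by blast+
  then have "f ` W V \<noteq> {\<zero>\<^bsub>B\<^esub>}" by blast
  moreover have "f ` W V \<subseteq> V" unfolding W_def by blast
  ultimately have essV: "essential R (restr B V) (f ` W V)"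
    using B.essential_in_uniform[OF V uV sfW] by blast
  have "inj_on f U"
  proof (rule inj_onI)
    fix x y assume xy: "x \<in> U" "y \<in> U" "f x = f y"
    have d: "x \<oplus>\<^bsub>A\<^esub> \<ominus>\<^bsub>A\<^esub> y \<in> U"
      using U xy A.submodule_minus[OF U] unfolding A.submodule_iff by blast
    have "f (x \<oplus>\<^bsub>A\<^esub> \<ominus>\<^bsub>A\<^esub> y) = \<zero>\<^bsub>B\<^esub>"
      using xy Uc by (simp add: hom_add hom_minus hom_closed B.r_neg)
    then have "x \<oplus>\<^bsub>A\<^esub> \<ominus>\<^bsub>A\<^esub> y = \<zero>\<^bsub>A\<^esub>" using fU d by blast
    then show "x = y" using Uc xy by (metis A.minus_equality A.minus_minus A.a_inv_closed)
  qed
  then have "bij_betw f (W V) (f ` W V)"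
    using WU inj_on_subset unfolding bij_betw_def by blast
  then have "iso_on R (restr A U) (restr B V) (W V) (f ` W V) f"
    using hom_add hom_smult Uc WU[of V] unfolding iso_on_def by (simp add: subset_iff)
  then show "ess_equiv R (restr A U) (restr B V)"
    using essU essV unfolding ess_equiv_iff by blast
qed

end

text \<open>Every uniform submodule of \<open>B\<close> is essentially equivalent to
  \<open>U\<close>, whose class is \<open>c\<close>. Both modules share one type so that their sets
  of classes can be compared.\<close>

lemma As_of_complement:
  fixes A B :: "('r, 'm, 'y) module_scheme"
  assumes hom: "left_module_hom R A B f" and surj: "f ` carrier A = carrier B"
    and comp: "left_module.uniform_complement R A U K"
    and ker: "K = {x \<in> carrier A. f x = \<zero>\<^bsub>B\<^esub>}" and As: "As R A = {c}"
  shows "As R B = {c}"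
proof -
  interpret left_module_hom R A B f by fact
  note uc = uniform_of_complement[OF surj comp ker]
  have U: "submodule U R A" "uniform_module R (restr A U)"
    using comp unfolding A.uniform_complement_def by blast+
  have c: "ess_class R (restr A U) = c" using As U unfolding As_def by blast
  have "ess_class R (restr B V) = c" if "submodule V R B" "uniform_module R (restr B V)" for V
    using ess_class_eqI[OF A.left_module_restr[OF U(1)] B.left_module_restr[OF that(1)] uc(2)[OF that]]
      c by simp
  \<comment> \<open>\<open>B\<close> is a uniform submodule of itself, so \<open>As R B\<close> is
    not empty.\<close>
  moreover have "submodule (carrier B) R B" "uniform_module R (restr B (carrier B))"
    using B.submodule_carrier uc(1) by simp_all
  ultimately show ?thesis unfolding As_def by blast
qed

section \<open>Factor modules, their natural epimorphisms, and the decomposition of one primary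
  component\<close>

context left_module
begin

lemma abelian_subgroup_of_submodule:
  assumes "submodule N R M" shows "abelian_subgroup N M"
  using assms M.abelian_group_axioms
  by (auto intro!: abelian_subgroupI3 additive_subgroup.intro dest: submodule.axioms(1))

lemma coset_eq_iff:
  assumes "submodule N R M" "x \<in> carrier M" "y \<in> carrier M"
  shows "N +>\<^bsub>M\<^esub> x = N +>\<^bsub>M\<^esub> y \<longleftrightarrow> x \<oplus>\<^bsub>M\<^esub> \<ominus>\<^bsub>M\<^esub> y \<in> N"
proof -
  interpret N: abelian_subgroup N M by (rule abelian_subgroup_of_submodule[OF assms(1)])
  show ?thesis
    using assms N.a_rcos_module[of y x] N.a_repr_independence'[of x y]
      N.a_rcos_self[of x] by metis
qed

lemma quot_module_simps:
  assumes N: "submodule N R M"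
  shows "carrier (quot_module M N) = (\<lambda>x. N +>\<^bsub>M\<^esub> x) ` carrier M"
    and "\<zero>\<^bsub>quot_module M N\<^esub> = N"
    and "x \<in> carrier M \<Longrightarrow> y \<in> carrier M \<Longrightarrow>
      (N +>\<^bsub>M\<^esub> x) \<oplus>\<^bsub>quot_module M N\<^esub> (N +>\<^bsub>M\<^esub> y) = N +>\<^bsub>M\<^esub> (x \<oplus>\<^bsub>M\<^esub> y)"
    and "a \<in> carrier R \<Longrightarrow> x \<in> carrier M \<Longrightarrow>
      a \<odot>\<^bsub>quot_module M N\<^esub> (N +>\<^bsub>M\<^esub> x) = N +>\<^bsub>M\<^esub> (a \<odot>\<^bsub>M\<^esub> x)"
proof -
  interpret N: abelian_subgroup N M by (rule abelian_subgroup_of_submodule[OF N])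
  show "carrier (quot_module M N) = (\<lambda>x. N +>\<^bsub>M\<^esub> x) ` carrier M"
    by (auto simp: quot_module_def A_RCOSETS_def')
  show "\<zero>\<^bsub>quot_module M N\<^esub> = N" by (simp add: quot_module_def)
  show "(N +>\<^bsub>M\<^esub> x) \<oplus>\<^bsub>quot_module M N\<^esub> (N +>\<^bsub>M\<^esub> y) = N +>\<^bsub>M\<^esub> (x \<oplus>\<^bsub>M\<^esub> y)"
    if "x \<in> carrier M" "y \<in> carrier M"
    using that by (simp add: quot_module_def N.a_rcos_sum)
  show "a \<odot>\<^bsub>quot_module M N\<^esub> (N +>\<^bsub>M\<^esub> x) = N +>\<^bsub>M\<^esub> (a \<odot>\<^bsub>M\<^esub> x)"
    if a: "a \<in> carrier R" and x: "x \<in> carrier M"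
  proof -
    \<comment> \<open>Scalar multiplication is a union over all representatives of the coset; all
      cosets in that union coincide.\<close>
    have "N +>\<^bsub>M\<^esub> (a \<odot>\<^bsub>M\<^esub> y) = N +>\<^bsub>M\<^esub> (a \<odot>\<^bsub>M\<^esub> x)" if y: "y \<in> N +>\<^bsub>M\<^esub> x" for y
    proof -
      obtain n where n: "n \<in> N" "y = n \<oplus>\<^bsub>M\<^esub> x" using y unfolding a_r_coset_def' by blast
      have nc: "n \<in> carrier M" and an: "a \<odot>\<^bsub>M\<^esub> n \<in> N"
        using N n a unfolding submodule_iff by blast+
      have "a \<odot>\<^bsub>M\<^esub> y \<oplus>\<^bsub>M\<^esub> \<ominus>\<^bsub>M\<^esub> (a \<odot>\<^bsub>M\<^esub> x) = a \<odot>\<^bsub>M\<^esub> n"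
        using n nc a x by (simp add: smult_r_distr M.a_assoc M.r_neg)
      then show ?thesis using an n nc a x by (simp add: coset_eq_iff[OF N])
    qed
    then have "(\<Union>y\<in>N +>\<^bsub>M\<^esub> x. N +>\<^bsub>M\<^esub> (a \<odot>\<^bsub>M\<^esub> y)) = (\<Union>y\<in>N +>\<^bsub>M\<^esub> x. N +>\<^bsub>M\<^esub> (a \<odot>\<^bsub>M\<^esub> x))"
      by (rule SUP_cong[OF refl])
    \<comment> \<open>The constant union collapses because its index set contains
      \<open>x\<close>.\<close>
    also have "\<dots> = N +>\<^bsub>M\<^esub> (a \<odot>\<^bsub>M\<^esub> x)" using N.a_rcos_self[OF x] by blast
    finally show ?thesis by (simp add: quot_module_def)
  qed
qed

lemma left_module_quot_module:
  assumes N: "submodule N R M" shows "left_module R (quot_module M N)"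
proof -
  note q = quot_module_simps[OF N]
  have z: "N = N +>\<^bsub>M\<^esub> \<zero>\<^bsub>M\<^esub>" using N unfolding submodule_iff by simp
  have zero: "\<zero>\<^bsub>quot_module M N\<^esub> = N +>\<^bsub>M\<^esub> \<zero>\<^bsub>M\<^esub>" using q(2) z by simp
  have inv: "\<exists>y\<in>carrier M. N +>\<^bsub>M\<^esub> (x \<oplus>\<^bsub>M\<^esub> y) = N +>\<^bsub>M\<^esub> \<zero>\<^bsub>M\<^esub>"
    if "x \<in> carrier M" for x
    using that by (metis M.a_inv_closed M.r_neg)
  \<comment> \<open>The zero is kept in the form of a coset, so that the formulas for cosets cover
    it; the rule turning it back into \<open>N\<close> is therefore disabled.\<close>
  have "abelian_group (quot_module M N)"
    by (rule abelian_groupI) (auto simp: q(1,3) zero M.a_ac inv simp del: M.a_coset_add_zero)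
  then show ?thesis
    by (auto intro!: left_module.intro left_module_axioms.intro R.ring_axioms
        simp: q(1,3,4) smult_l_distr smult_r_distr smult_assoc)
qed

lemma coset_hom:
  assumes N: "submodule N R M" shows "left_module_hom R M (quot_module M N) (\<lambda>x. N +>\<^bsub>M\<^esub> x)"
proof -
  interpret Q: left_module R "quot_module M N" by (rule left_module_quot_module[OF N])
  show ?thesis by unfold_locales (auto simp: quot_module_simps[OF N])
qed

lemma coset_eq_self_iff:
  assumes "submodule N R M" "x \<in> carrier M"
  shows "N +>\<^bsub>M\<^esub> x = N \<longleftrightarrow> x \<in> N"
  proof -
  have "N +>\<^bsub>M\<^esub> \<zero>\<^bsub>M\<^esub> = N" using assms(1) unfolding submodule_iff by simp
  moreover have "x \<oplus>\<^bsub>M\<^esub> \<ominus>\<^bsub>M\<^esub> \<zero>\<^bsub>M\<^esub> = x" using assms(2) by (simp add: M.add.inv_one)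
  ultimately show ?thesis using coset_eq_iff[OF assms(1,2) M.zero_closed] by simp
qed

text \<open>The natural epimorphism \<open>M/P \<rightarrow> M/L\<close>, realised on cosets as \<open>X \<mapsto> L + X\<close>.\<close>

lemma quotient_hom:
  assumes P: "submodule P R M" and L: "submodule L R M" and PL: "P \<subseteq> L"
  shows "left_module_hom R (quot_module M P) (quot_module M L) (\<lambda>X. L <+>\<^bsub>M\<^esub> X)"
    and "x \<in> carrier M \<Longrightarrow> L <+>\<^bsub>M\<^esub> (P +>\<^bsub>M\<^esub> x) = L +>\<^bsub>M\<^esub> x"
proof -
  interpret LM: abelian_subgroup L M by (rule abelian_subgroup_of_submodule[OF L])
  interpret PM: abelian_subgroup P M by (rule abelian_subgroup_of_submodule[OF P])
  have LP: "L <+>\<^bsub>M\<^esub> P = L"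
  proof
    show "L <+>\<^bsub>M\<^esub> P \<subseteq> L" using PL by (auto simp: set_add_def')
    show "L \<subseteq> L <+>\<^bsub>M\<^esub> P"
    proof
      fix x assume x: "x \<in> L"
      then have "x = x \<oplus>\<^bsub>M\<^esub> \<zero>\<^bsub>M\<^esub>" by simp
      then show "x \<in> L <+>\<^bsub>M\<^esub> P" using x PM.zero_closed unfolding set_add_def' by blast
    qed
  qed
  show eq: "L <+>\<^bsub>M\<^esub> (P +>\<^bsub>M\<^esub> x) = L +>\<^bsub>M\<^esub> x" if "x \<in> carrier M" for x
    using M.a_setmult_rcos_assoc[OF LM.a_subset PM.a_subset that] LP by simp
  interpret QP: left_module R "quot_module M P" by (rule left_module_quot_module[OF P])
  interpret QL: left_module R "quot_module M L" by (rule left_module_quot_module[OF L])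
  show "left_module_hom R (quot_module M P) (quot_module M L) (\<lambda>X. L <+>\<^bsub>M\<^esub> X)"
    by unfold_locales (auto simp: quot_module_simps[OF P] quot_module_simps[OF L] eq)
qed

text \<open>The complements found in \<open>M/P\<close> are pulled back to \<open>M\<close>.
  Factoring \<open>M\<close> by a preimage represents the quotient of \<open>M/P\<close> by the
  complement on the same type as \<open>M/P\<close>, where a quotient of the quotient would consist
  of sets of cosets.\<close>

lemma primary_submodule_uniform_family:
  assumes P: "submodule P R M" and fin: "finite_udim R (quot_module M P)"
    and As: "As R (quot_module M P) = {c}"
  obtains F where "finite F" "F \<noteq> {}" "\<Inter>F = P"
    "\<forall>L\<in>F. submodule L R M \<and> uniform_module R (quot_module M L) \<and>
      As R (quot_module M L) = {c}"
proof -
  let ?Q = "quot_module M P" and ?p = "\<lambda>x. P +>\<^bsub>M\<^esub> x"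
  interpret Q: left_module R ?Q by (rule left_module_quot_module[OF P])
  interpret p: left_module_hom R M ?Q ?p by (rule coset_hom[OF P])
  have "carrier ?Q \<noteq> {\<zero>\<^bsub>?Q\<^esub>}"
  proof
    assume z: "carrier ?Q = {\<zero>\<^bsub>?Q\<^esub>}"
    \<comment> \<open>The class \<open>c\<close> must come from some uniform submodule, which is
      nonzero by definition.\<close>
    obtain U where U: "submodule U R ?Q" "uniform_module R (restr ?Q U)"
      using singletonI[of c] unfolding As[symmetric] As_def mem_Collect_eq by blast
    have "U = {\<zero>\<^bsub>?Q\<^esub>}" using U(1) z unfolding Q.submodule_iff by (metis subset_singletonD empty_iff)
    then show False using U(2) Q.uniform_restr_iff[OF U(1)] by simp
  qed
  then obtain F where F: "finite F" "F \<noteq> {}" "\<forall>K\<in>F. \<exists>U. Q.uniform_complement U K"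
    "\<Inter>F = {\<zero>\<^bsub>?Q\<^esub>}"
    by (rule Q.finite_complement_intersection[OF fin])
  let ?v = "\<lambda>K. {x \<in> carrier M. ?p x \<in> K}"
  have "\<Inter>(?v ` F) = P"
  proof -
    have "\<Inter>(?v ` F) = {x \<in> carrier M. ?p x \<in> \<Inter>F}" using F(2) by auto
    also have "\<dots> = {x \<in> carrier M. x \<in> P}"
      using coset_eq_self_iff[OF P] by (simp add: F(4) quot_module_simps(2)[OF P] cong: conj_cong)
    also have "\<dots> = P" using P unfolding submodule_iff by blast
    finally show ?thesis .
  qed
  moreover have "submodule (?v K) R M \<and> uniform_module R (quot_module M (?v K)) \<and>
      As R (quot_module M (?v K)) = {c}" if KF: "K \<in> F" for K
  proof -
    obtain U where U: "Q.uniform_complement U K" using F(3) KF by blast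
    then have K: "submodule K R ?Q" unfolding Q.uniform_complement_def by blast
    have L: "submodule (?v K) R M" by (rule p.submodule_vimage[OF K])
    \<comment> \<open>\<open>calculation\<close> is the identity just shown, that the preimages
      intersect in \<open>P\<close>.\<close>
    have PL: "P \<subseteq> ?v K" using calculation KF by blast
    let ?g = "\<lambda>X. ?v K <+>\<^bsub>M\<^esub> X"
    note g = quotient_hom[OF P L PL]
    have surj: "?g ` carrier ?Q = carrier (quot_module M (?v K))"
      by (simp add: quot_module_simps(1)[OF P] quot_module_simps(1)[OF L] image_image g(2))
    have ker: "K = {X \<in> carrier ?Q. ?g X = \<zero>\<^bsub>quot_module M (?v K)\<^esub>}"
    proof -
      have "?p x \<in> K \<longleftrightarrow> ?g (?p x) = ?v K" if "x \<in> carrier M" for x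
        using that coset_eq_self_iff[OF L that] by (simp add: g(2))
      moreover have "K \<subseteq> ?p ` carrier M"
        using K unfolding Q.submodule_iff quot_module_simps(1)[OF P] by (rule conjunct1)
      ultimately show ?thesis
        unfolding quot_module_simps(1)[OF P] quot_module_simps(2)[OF L] by blast
    qed
    show ?thesis
      using L As_of_complement[OF g(1) surj U ker As]
        left_module_hom.uniform_of_complement(1)[OF g(1) surj U ker] by blast
  qed
  ultimately show thesis using F(1,2) by (intro that[of "?v ` F"]) auto
qed

end

section \<open>Assembling the families of all components into one refinement\<close>

theorem lemma6p7:
  fixes R :: "('r, 'x) ring_scheme"
    and M :: "('r, 'm, 'y) module_scheme"
    and N :: "'m set"
    and s :: nat
    and Ms :: "nat \<Rightarrow> 'm set"
  assumes "ring R"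
    and "left_module R M"
    and "carrier M \<noteq> {\<zero>\<^bsub>M\<^esub>}"
    and "uniformly_finite R M"
    and "submodule N R M"
    and "N \<noteq> carrier M"
    and "primary_decomposition R M N s Ms"
  shows "\<exists>t Ns. refinement R M N t Ns s Ms \<and> uniform_decomposition R M N t Ns"
proof -
  interpret left_module R M by fact
  note dec = assms(7)[unfolded primary_decomposition_def]
  have s: "s \<ge> 1" using dec by (rule conjunct1)
  have prim: "primary_submodule R M (Ms j)" if "j \<in> {1..s}" for j
    using dec that by (elim conjE) (rule bspec)
  have N: "N = (\<Inter>j\<in>{1..s}. Ms j)" using dec by (elim conjE)
  have "\<exists>F. finite F \<and> F \<noteq> {} \<and> \<Inter>F = Ms j \<and> (\<forall>L\<in>F. submodule L R M \<and>
      uniform_module R (quot_module M L) \<and> As R (quot_module M L) = As R (quot_module M (Ms j)))"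
    if j: "j \<in> {1..s}" for j
  proof -
    obtain c where Ms: "submodule (Ms j) R M" "finite_udim R (quot_module M (Ms j))"
      and c: "As R (quot_module M (Ms j)) = {c}"
      using prim[OF j] unfolding primary_submodule_def by blast
    obtain F where "finite F" "F \<noteq> {}" "\<Inter>F = Ms j" and "\<forall>L\<in>F.
        submodule L R M \<and> uniform_module R (quot_module M L) \<and> As R (quot_module M L) = {c}"
      by (rule primary_submodule_uniform_family[OF Ms c])
    then show ?thesis using c by (intro exI[of _ F]) simp
  qed
  then obtain F where F: "\<And>j. j \<in> {1..s} \<Longrightarrow> finite (F j) \<and> F j \<noteq> {} \<and> \<Inter>(F j) = Ms j \<and>
      (\<forall>L\<in>F j. submodule L R M \<and> uniform_module R (quot_module M L) \<and>
        As R (quot_module M L) = As R (quot_module M (Ms j)))" by metis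
  \<comment> \<open>Pairs keep the families disjoint: a submodule occurring in \<open>F j\<close>
    for several \<open>j\<close> receives a separate index for each.\<close>
  let ?S = "Sigma {1..s} F"
  have "finite ?S" using F by blast
  \<comment> \<open>The enumeration starts at 1, as the indexing of decompositions does.\<close>
  then obtain h where h: "bij_betw h {1..card ?S} ?S" using ex_bij_betw_nat_finite_1 by blast
  define t where "t = card ?S"
  define Ns where "Ns k = snd (h k)" for k
  \<comment> \<open>The blocks are the fibres of the first coordinate, hence disjoint by
    construction.\<close>
  define I where "I j = {k \<in> {1..t}. fst (h k) = j}" for j
  have hS: "h ` {1..t} = ?S" using h unfolding t_def bij_betw_def by blast
  have NsI: "Ns ` I j = F j" if "j \<in> {1..s}" for j
  proof
    show "Ns ` I j \<subseteq> F j" using hS unfolding Ns_def I_def by force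
    show "F j \<subseteq> Ns ` I j"
    proof
      fix L assume "L \<in> F j"
      then have "(j, L) \<in> h ` {1..t}" using that hS by blast
      then obtain k where "k \<in> {1..t}" "h k = (j, L)" by (metis imageE)
      then show "L \<in> Ns ` I j" unfolding Ns_def I_def by force
    qed
  qed
  have "fst (h k) \<in> {1..s}" if "k \<in> {1..t}" for k
  proof -
    have "h k \<in> ?S" using hS that by blast
    then show ?thesis by (cases "h k") simp
  qed
  then have UI: "(\<Union>j\<in>{1..s}. I j) = {1..t}" unfolding I_def by blast
  have Ne: "I j \<noteq> {}" if "j \<in> {1..s}" for j using NsI[OF that] F[OF that] by auto
  have Int: "Ms j = (\<Inter>k\<in>I j. Ns k)" if "j \<in> {1..s}" for j
    using NsI[OF that] F[OF that] by simp
  have comp: "submodule (Ns k) R M" "uniform_module R (quot_module M (Ns k))"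
    "As R (quot_module M (Ns k)) = As R (quot_module M (Ms j))"
    if "j \<in> {1..s}" "k \<in> I j" for j k
  proof -
    have "Ns k \<in> F j" using NsI[OF that(1)] that(2) by blast
    then show "submodule (Ns k) R M" "uniform_module R (quot_module M (Ns k))"
      "As R (quot_module M (Ns k)) = As R (quot_module M (Ms j))" using F[OF that(1)] by simp_all
  qed
  have NNs: "N = (\<Inter>k\<in>{1..t}. Ns k)" unfolding N UI[symmetric] using Int by auto
  have t: "t \<ge> 1"
  proof -
    have "1 \<in> {1..s}" using s by simp
    then obtain k where "k \<in> {1..t}" using Ne[of 1] UI by blast
    then show ?thesis by simp
  qed
  have comp': "submodule (Ns k) R M" "uniform_module R (quot_module M (Ns k))"
    "primary_submodule R M (Ns k)" if k: "k \<in> {1..t}" for k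
  proof -
    obtain j where j: "j \<in> {1..s}" "k \<in> I j" using k UI by blast
    show "submodule (Ns k) R M" "uniform_module R (quot_module M (Ns k))" using comp[OF j] by auto
    \<comment> \<open>Finite uniform dimension comes from uniform finiteness of \<open>M\<close>,
      and the single class is inherited from the component \<open>Ms j\<close>.\<close>
    then show "primary_submodule R M (Ns k)"
      using comp(3)[OF j] prim[OF j(1)] assms(4)
      unfolding primary_submodule_def uniformly_finite_def by simp
  qed
  have "primary_decomposition R M N t Ns" "uniform_decomposition R M N t Ns"
    unfolding primary_decomposition_def uniform_decomposition_def
    using t comp' NNs by (intro conjI ballI; assumption | simp)+
  moreover have "disjoint_family_on I {1..s}" unfolding disjoint_family_on_def I_def by blast
  ultimately show ?thesis
    using assms(7) Ne UI Int comp(3) unfolding refinement_def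
    by (intro exI[of _ t] exI[of _ Ns] exI[of _ I] conjI ballI) simp_all
qed

end
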